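(* Let $\rho_1,\rho_2$ be convex expectations on $L^\infty(\mu)$ that are continuous from below. Then the optimal test of the problem of minimizing $\rho_2(K_2-X)$ over $\mathcal{X}_\alpha$ exists, i.e. there is $X^*\in\mathcal{X}_\alpha$ such that $\rho_2(K_2-X^* )=\inf_{X\in\mathcal{X}_\alpha}\rho_2(K_2-X)$.
   Context: $(\Omega,\mathcal{F},\mu)$ is a probability space. A convex expectation on $L^\infty(\mu)$ is a map $\rho:L^\infty(\mu)\to\mathbb{R}$ such that for all $X,Y\in L^\infty(\mu)$: (i) $X\ge Y$ implies $\rho(X)\ge\rho(Y)$; (ii) $\rho(X+c)=\rho(X)+c$ for every constant $c$; (iii) $\rho(\lambda X+(1-\lambda)Y)\le\lambda\rho(X)+(1-\lambda)\rho(Y)$ for $\lambda\in[0,1]$. It is continuous from below if $\rho(X_n)\to\rho(X)$ whenever $(X_n)\subset L^\infty(\mu)$ increases to $X\in L^\infty(\mu)$. $K_1,K_2\in L^\infty(\mu)$ are fixed with $0\le K_1<K_2$ ($\mu$-a.e.), and $\alpha$ is a fixed real number (significance level) with $\rho_1(K_1)\le\alpha\le\rho_1(K_2)$. $\mathcal{X}_\alpha=\{X\in L^\infty(\mu):K_1\le X\le K_2,\ \rho_1(X)\le\alpha\}$. *)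

theory Defs
  imports "HOL-Probability.Probability"
begin

text \<open>
  Elements of the space of essentially bounded random variables are represented by measurable
  functions. Order, equality and convergence between them are always meant almost everywhere,
  so that this is the space of equivalence classes up to the choice of representatives.
\<close>

definition Linf :: "'a measure \<Rightarrow> ('a \<Rightarrow> real) set" where
  "Linf M = {X. X \<in> borel_measurable M \<and> (\<exists>C. AE w in M. \<bar>X w\<bar> \<le> C)}"

text \<open>
  The values of \<open>\<rho>\<close> off \<^term>\<open>Linf M\<close> are irrelevant. Monotonicity with respect to the almost
  everywhere order forces \<open>\<rho> X = \<rho> Y\<close> whenever \<open>X = Y\<close> almost everywhere, so \<open>\<rho>\<close> is a
  well-defined map on equivalence classes.
\<close>

definition convex_expectation :: "'a measure \<Rightarrow> (('a \<Rightarrow> real) \<Rightarrow> real) \<Rightarrow> bool" where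
  "convex_expectation M \<rho> \<longleftrightarrow>
     (\<forall>X\<in>Linf M. \<forall>Y\<in>Linf M. (AE w in M. X w \<ge> Y w) \<longrightarrow> \<rho> X \<ge> \<rho> Y) \<and>
     (\<forall>X\<in>Linf M. \<forall>c::real. \<rho> (\<lambda>w. X w + c) = \<rho> X + c) \<and>
     (\<forall>X\<in>Linf M. \<forall>Y\<in>Linf M. \<forall>l::real. 0 \<le> l \<and> l \<le> 1 \<longrightarrow>
        \<rho> (\<lambda>w. l * X w + (1 - l) * Y w) \<le> l * \<rho> X + (1 - l) * \<rho> Y)"

definition continuous_from_below :: "'a measure \<Rightarrow> (('a \<Rightarrow> real) \<Rightarrow> real) \<Rightarrow> bool" where
  "continuous_from_below M \<rho> \<longleftrightarrow>
     (\<forall>(X :: nat \<Rightarrow> 'a \<Rightarrow> real) Y.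
        (\<forall>n. X n \<in> Linf M) \<and> Y \<in> Linf M \<and>
        (\<forall>n. AE w in M. X n w \<le> X (Suc n) w) \<and>
        (AE w in M. (\<lambda>n. X n w) \<longlonglongrightarrow> Y w)
        \<longrightarrow> (\<lambda>n. \<rho> (X n)) \<longlonglongrightarrow> \<rho> Y)"

definition admissible_tests ::
  "'a measure \<Rightarrow> (('a \<Rightarrow> real) \<Rightarrow> real) \<Rightarrow> ('a \<Rightarrow> real) \<Rightarrow> ('a \<Rightarrow> real) \<Rightarrow> real \<Rightarrow> ('a \<Rightarrow> real) set"
where
  "admissible_tests M \<rho>\<^sub>1 K\<^sub>1 K\<^sub>2 \<alpha> =
     {X \<in> Linf M. (AE w in M. K\<^sub>1 w \<le> X w \<and> X w \<le> K\<^sub>2 w) \<and> \<rho>\<^sub>1 X \<le> \<alpha>}"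

end

theory Submission
  imports Defs
begin

text \<open>
  The proof is the direct method of the calculus of variations, arranged so that it needs neither
  weak topologies nor the dual representation of a convex expectation.

  Let \<open>m\<close> be the infimum. The sets of admissible \<open>X\<close> with \<open>\<rho>\<^sub>2 (K\<^sub>2 - X) \<le> m + 1/(n+1)\<close> are
  nonempty, convex and decreasing in \<open>n\<close>, and all their elements lie between \<open>K\<^sub>1\<close> and \<open>K\<^sub>2\<close>.
  Compactness is replaced by a choice inside these sets: if \<open>X n\<close> is taken in the \<open>n\<close>-th set with
  nearly minimal second moment, the parallelogram identity makes \<open>X\<close> a Cauchy sequence in mean
  square, because midpoints remain in the set. A subsequence then converges almost everywhere
  (\<open>decreasing_midpoint_convex_AE_convergent_selection\<close>).

  What remains is to pass to the limit in \<open>\<rho>\<^sub>1 (X n) \<le> \<alpha>\<close> and in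
  \<open>\<rho>\<^sub>2 (K\<^sub>2 - X n) \<le> m + 1/(n+1)\<close>. Both follow from a Fatou property
  (\<open>continuous_from_below_Fatou\<close>), which monotonicity and continuity from below provide: the tail
  infima of an almost everywhere convergent sequence increase to its limit.
\<close>

section \<open>Essentially bounded functions and convex expectations\<close>

lemma LinfI:
  assumes "X \<in> borel_measurable M" "AE w in M. \<bar>X w\<bar> \<le> C"
  shows "X \<in> Linf M"
  using assms by (auto simp: Linf_def)

lemma Linf_measurable: "X \<in> Linf M \<Longrightarrow> X \<in> borel_measurable M"
  by (simp add: Linf_def)

lemma Linf_bound:
  assumes "X \<in> Linf M"
  obtains C where "AE w in M. \<bar>X w\<bar> \<le> C"
  using assms by (auto simp: Linf_def)

lemma Linf_diff:
  assumes "X \<in> Linf M" "Y \<in> Linf M"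
  shows "(\<lambda>w. X w - Y w) \<in> Linf M"
proof -
  obtain C where C: "AE w in M. \<bar>X w\<bar> \<le> C" by (rule Linf_bound[OF assms(1)])
  obtain D where D: "AE w in M. \<bar>Y w\<bar> \<le> D" by (rule Linf_bound[OF assms(2)])
  have "AE w in M. \<bar>X w - Y w\<bar> \<le> C + D"
    using C D by eventually_elim auto
  moreover have "(\<lambda>w. X w - Y w) \<in> borel_measurable M"
    using assms[THEN Linf_measurable] by measurable
  ultimately show ?thesis
    by (rule LinfI[rotated])
qed

lemma Linf_midpoint:
  assumes "X \<in> Linf M" "Y \<in> Linf M"
  shows "(\<lambda>w. (X w + Y w) / 2) \<in> Linf M"
proof -
  obtain C where C: "AE w in M. \<bar>X w\<bar> \<le> C" by (rule Linf_bound[OF assms(1)])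
  obtain D where D: "AE w in M. \<bar>Y w\<bar> \<le> D" by (rule Linf_bound[OF assms(2)])
  have "AE w in M. \<bar>(X w + Y w) / 2\<bar> \<le> (C + D) / 2"
    using C D by eventually_elim auto
  moreover have "(\<lambda>w. (X w + Y w) / 2) \<in> borel_measurable M"
    using assms[THEN Linf_measurable] by measurable
  ultimately show ?thesis
    by (rule LinfI[rotated])
qed

lemma convex_expectation_mono:
  assumes "convex_expectation M \<rho>" "X \<in> Linf M" "Y \<in> Linf M" "AE w in M. X w \<le> Y w"
  shows "\<rho> X \<le> \<rho> Y"
  using assms by (auto simp: convex_expectation_def)

lemma convex_expectation_midpoint_le:
  assumes "convex_expectation M \<rho>" "X \<in> Linf M" "Y \<in> Linf M" "\<rho> X \<le> c" "\<rho> Y \<le> c"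
  shows "\<rho> (\<lambda>w. (X w + Y w) / 2) \<le> c"
proof -
  have "\<forall>l::real. 0 \<le> l \<and> l \<le> 1 \<longrightarrow>
      \<rho> (\<lambda>w. l * X w + (1 - l) * Y w) \<le> l * \<rho> X + (1 - l) * \<rho> Y"
    using assms(1-3) unfolding convex_expectation_def by blast
  from this[rule_format, of "1/2"]
  have "\<rho> (\<lambda>w. (1/2) * X w + (1 - 1/2) * Y w) \<le> (1/2) * \<rho> X + (1 - 1/2) * \<rho> Y"
    by simp
  moreover have "(\<lambda>w. (1/2) * X w + (1 - 1/2) * Y w) = (\<lambda>w. (X w + Y w) / 2)"
    by (auto simp: field_simps)
  ultimately have "\<rho> (\<lambda>w. (X w + Y w) / 2) \<le> (1/2) * \<rho> X + (1 - 1/2) * \<rho> Y"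
    by simp
  with assms show ?thesis by simp
qed

section \<open>The Fatou property\<close>

lemma tail_INF_LIMSEQ:
  fixes x :: "nat \<Rightarrow> real"
  assumes "x \<longlonglongrightarrow> l"
  shows "(\<lambda>n. INF k. x (n + k)) \<longlonglongrightarrow> l"
proof (rule LIMSEQ_I)
  fix e :: real assume "0 < e"
  then obtain N where N: "\<And>n. n \<ge> N \<Longrightarrow> \<bar>x n - l\<bar> < e / 2"
    using LIMSEQ_D[OF assms, of "e / 2"] by auto
  have "\<bar>(INF k. x (n + k)) - l\<bar> < e" if "n \<ge> N" for n
  proof -
    have lower: "l - e / 2 \<le> x (n + k)" for k
      using N[of "n + k"] that by linarith
    then have "l - e / 2 \<le> (INF k. x (n + k))"
      by (intro cINF_greatest) auto
    moreover have "(INF k. x (n + k)) \<le> x (n + 0)"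
      using lower by (intro cINF_lower) (auto simp: bdd_below_def)
    ultimately show ?thesis
      using N[OF that] \<open>0 < e\<close> unfolding abs_less_iff by auto
  qed
  then show "\<exists>N. \<forall>n\<ge>N. norm ((INF k. x (n + k)) - l) < e"
    by auto
qed

text \<open>
  The tail infima of \<open>X\<close> increase to \<open>Y\<close>, so continuity from below applies to them, and each of
  them lies below the corresponding \<open>X n\<close>, so monotonicity transfers the bound \<open>c n\<close> to it.
\<close>

lemma continuous_from_below_Fatou:
  fixes X :: "nat \<Rightarrow> 'a \<Rightarrow> real"
  assumes \<rho>: "convex_expectation M \<rho>" "continuous_from_below M \<rho>"
    and X: "\<And>n. X n \<in> Linf M" and Y: "Y \<in> Linf M"
    and bound: "AE w in M. \<forall>n. \<bar>X n w\<bar> \<le> B"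
    and conv: "AE w in M. (\<lambda>n. X n w) \<longlonglongrightarrow> Y w"
    and le: "\<And>n. \<rho> (X n) \<le> c n" and c: "c \<longlonglongrightarrow> c'"
  shows "\<rho> Y \<le> c'"
proof -
  define Z where "Z n w = (INF k. X (n + k) w)" for n w
  have [measurable]: "X n \<in> borel_measurable M" for n
    using X by (rule Linf_measurable)
  have Z_measurable: "Z n \<in> borel_measurable M" for n
    unfolding Z_def by measurable
  have bdd: "bdd_below (range (\<lambda>k. X (n + k) w))" if "\<forall>n. \<bar>X n w\<bar> \<le> B" for n w
    using that by (auto simp: bdd_below_def abs_le_iff intro!: exI[of _ "- B"]) (smt (verit))
  have Z_le: "AE w in M. Z n w \<le> X n w" for n
    using bound
  proof eventually_elim
    case (elim w)
    show ?case
      unfolding Z_def using cINF_lower[OF bdd[OF elim], of 0 n] by simp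
  qed
  have Z_bound: "AE w in M. \<bar>Z n w\<bar> \<le> B" for n
    using bound Z_le[of n]
  proof eventually_elim
    case (elim w)
    have "- B \<le> X (n + k) w" for k
      using elim(1) by (smt (verit))
    then have "- B \<le> Z n w"
      unfolding Z_def by (intro cINF_greatest) auto
    then show ?case
      using elim by (smt (verit))
  qed
  have Z_Linf: "Z n \<in> Linf M" for n
    using Z_measurable Z_bound by (rule LinfI)
  have Z_incr: "AE w in M. Z n w \<le> Z (Suc n) w" for n
    using bound
  proof eventually_elim
    case (elim w)
    have "Z n w \<le> X (Suc n + k) w" for k
      unfolding Z_def using cINF_lower[OF bdd[OF elim], of "Suc k" n] by simp
    then show ?case
      unfolding Z_def[of "Suc n"] by (intro cINF_greatest) auto
  qed
  have "AE w in M. (\<lambda>n. Z n w) \<longlonglongrightarrow> Y w"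
    using conv unfolding Z_def by eventually_elim (rule tail_INF_LIMSEQ)
  then have "(\<lambda>n. \<rho> (Z n)) \<longlonglongrightarrow> \<rho> Y"
    using \<rho>(2) Z_Linf Y Z_incr unfolding continuous_from_below_def by blast
  moreover have "\<rho> (Z n) \<le> c n" for n
    using convex_expectation_mono[OF \<rho>(1) Z_Linf X Z_le] le by (rule order_trans)
  ultimately show ?thesis
    using c by (blast intro: LIMSEQ_le)
qed

section \<open>Almost everywhere convergent selections\<close>

text \<open>
  Young's inequality \<open>\<bar>d\<bar> \<le> e/2 + d\<^sup>2/(2e)\<close> compares the first moment with the second.
\<close>

lemma (in prob_space) integral_abs_less_if_integral_square_less:
  fixes d :: "'a \<Rightarrow> real"
  assumes "integrable M d" "integrable M (\<lambda>w. (d w)\<^sup>2)" and e: "e > 0"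
    and less: "(\<integral>w. (d w)\<^sup>2 \<partial>M) < e\<^sup>2"
  shows "(\<integral>w. \<bar>d w\<bar> \<partial>M) < e"
proof -
  have pointwise: "\<bar>d w\<bar> \<le> e / 2 + (d w)\<^sup>2 / (2 * e)" for w
  proof -
    have "0 \<le> (\<bar>d w\<bar> - e)\<^sup>2" by simp
    then have "2 * e * \<bar>d w\<bar> \<le> e\<^sup>2 + (d w)\<^sup>2"
      by (simp add: power2_diff algebra_simps)
    then show ?thesis
      using e by (simp add: field_simps power2_eq_square)
  qed
  have "(\<integral>w. \<bar>d w\<bar> \<partial>M) \<le> (\<integral>w. e / 2 + (d w)\<^sup>2 / (2 * e) \<partial>M)"
    using assms by (intro integral_mono pointwise) auto
  also have "\<dots> = e / 2 + (\<integral>w. (d w)\<^sup>2 \<partial>M) / (2 * e)"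
    using assms by (simp add: prob_space)
  also have "\<dots> < e / 2 + e\<^sup>2 / (2 * e)"
    using less e by (simp add: divide_strict_right_mono)
  also have "\<dots> = e"
    using e by (simp add: power2_eq_square)
  finally show ?thesis .
qed

text \<open>
  This replaces weak compactness. With \<open>a n\<close> the infimum of the second moment over \<open>C n\<close>, and
  \<open>S n \<in> C n\<close> within \<open>1/(n+1)\<close> of it, the midpoint of \<open>S n\<close> and \<open>S m\<close> for \<open>n \<le> m\<close> has second moment
  at least \<open>a n\<close>, so the parallelogram identity bounds the second moment of \<open>S n - S m\<close> by
  \<open>2 (a m - a n) + 2/(n+1) + 2/(m+1)\<close>. The sequence \<open>a\<close> is increasing and bounded, hence Cauchy.
  A subsequence of \<open>S\<close> converges almost everywhere, and stays a selection because the sets decrease.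
\<close>

lemma (in prob_space) decreasing_midpoint_convex_AE_convergent_selection:
  fixes C :: "nat \<Rightarrow> ('a \<Rightarrow> real) set"
  assumes decr: "\<And>n m. n \<le> m \<Longrightarrow> C m \<subseteq> C n"
    and nonempty: "\<And>n. C n \<noteq> {}"
    and meas: "\<And>n X. X \<in> C n \<Longrightarrow> X \<in> borel_measurable M"
    and bound: "\<And>n X. X \<in> C n \<Longrightarrow> AE w in M. \<bar>X w\<bar> \<le> B"
    and midpoint: "\<And>n X Y. X \<in> C n \<Longrightarrow> Y \<in> C n \<Longrightarrow> (\<lambda>w. (X w + Y w) / 2) \<in> C n"
  obtains X Y where "\<And>n. X n \<in> C n" "Y \<in> borel_measurable M"
    "AE w in M. (\<lambda>n. X n w) \<longlonglongrightarrow> Y w"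
proof -
  define q where "q X = (\<integral>w. (X w)\<^sup>2 \<partial>M)" for X :: "'a \<Rightarrow> real"
  define a where "a n = (INF X\<in>C n. q X)" for n
  have int: "integrable M X" if "X \<in> C n" for n X
    using integrable_const_bound[of X B] bound[OF that] meas[OF that] by simp
  have int_mult: "integrable M (\<lambda>w. X w * Y w)" if "X \<in> C n" "Y \<in> C m" for n m X Y
  proof (rule integrable_const_bound)
    show "AE w in M. norm (X w * Y w) \<le> B * B"
      using bound[OF that(1)] bound[OF that(2)]
      by eventually_elim (auto simp: abs_mult intro!: mult_mono)
  qed (use that meas in auto)
  have int_sq: "integrable M (\<lambda>w. (X w)\<^sup>2)" if "X \<in> C n" for n X
    using int_mult[OF that that] by (simp add: power2_eq_square)
  have q_nonneg: "0 \<le> q X" for X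
    by (simp add: q_def)
  have q_le: "q X \<le> B\<^sup>2" if "X \<in> C n" for n X
  proof -
    have "q X \<le> (\<integral>w. B\<^sup>2 \<partial>M)"
      unfolding q_def using int_sq[OF that]
    proof (rule integral_mono_AE)
      show "AE w in M. (X w)\<^sup>2 \<le> B\<^sup>2"
        using bound[OF that] by eventually_elim (metis abs_ge_zero power2_abs power_mono)
    qed simp
    then show ?thesis by (simp add: prob_space)
  qed
  have q_bdd: "bdd_below (q ` C n)" for n
    using q_nonneg by (auto simp: bdd_below_def)
  have a_le: "a n \<le> q X" if "X \<in> C n" for n X
    unfolding a_def using q_bdd that by (rule cINF_lower)
  have "incseq a"
    unfolding incseq_def a_def using cINF_superset_mono[OF nonempty q_bdd decr] by simp
  moreover have "a n \<le> B\<^sup>2" for n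
    using nonempty[of n] a_le q_le by (meson all_not_in_conv order_trans)
  ultimately obtain a' where "a \<longlonglongrightarrow> a'"
    using incseq_convergent by metis
  then have "Cauchy a"
    by (rule LIMSEQ_imp_Cauchy)
  define \<delta> where "\<delta> n = 1 / real (Suc n)" for n
  have "\<exists>X\<in>C n. q X < a n + \<delta> n" for n
    using cINF_less_iff[OF nonempty q_bdd, of n "a n + \<delta> n"] by (simp add: a_def \<delta>_def)
  then obtain S where S: "\<And>n. S n \<in> C n" and S_q: "\<And>n. q (S n) < a n + \<delta> n"
    by metis
  have gap: "q (\<lambda>w. S n w - S m w) \<le> 2 * (a m - a n) + 2 * \<delta> n + 2 * \<delta> m"
    if "n \<le> m" for n m
  proof -
    have "S m \<in> C n"
      using S decr[OF that] by blast
    then have mid: "(\<lambda>w. (S n w + S m w) / 2) \<in> C n"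
      using S midpoint by blast
    have "q (\<lambda>w. S n w - S m w)
        = (\<integral>w. 2 * (S n w)\<^sup>2 + 2 * (S m w)\<^sup>2 - 4 * ((S n w + S m w) / 2)\<^sup>2 \<partial>M)"
      unfolding q_def by (rule Bochner_Integration.integral_cong)
        (simp_all add: power2_eq_square field_simps)
    also have "\<dots> = 2 * q (S n) + 2 * q (S m) - 4 * q (\<lambda>w. (S n w + S m w) / 2)"
      unfolding q_def using int_sq[OF S] int_sq[OF mid]
      by simp
    also have "\<dots> \<le> 2 * (a n + \<delta> n) + 2 * (a m + \<delta> m) - 4 * a n"
      using S_q a_le[OF mid] by (intro diff_mono add_mono mult_left_mono) (auto intro: less_imp_le)
    finally show ?thesis by (simp add: algebra_simps)
  qed
  have L1_Cauchy: "\<exists>N. \<forall>i\<ge>N. \<forall>j\<ge>N. (\<integral>w. norm (S i w - S j w) \<partial>M) < e" if "e > 0" for e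
  proof -
    have "e\<^sup>2 / 8 > 0" using that by simp
    obtain N1 where N1: "\<And>i j. i \<ge> N1 \<Longrightarrow> j \<ge> N1 \<Longrightarrow> \<bar>a i - a j\<bar> < e\<^sup>2 / 8"
      using CauchyD[OF \<open>Cauchy a\<close> \<open>e\<^sup>2 / 8 > 0\<close>] by auto
    obtain N2 where N2: "\<delta> N2 < e\<^sup>2 / 8"
      using nat_approx_posE[OF \<open>e\<^sup>2 / 8 > 0\<close>] unfolding \<delta>_def by blast
    have small: "\<delta> i < e\<^sup>2 / 8" if "i \<ge> N2" for i
    proof -
      have "\<delta> i \<le> \<delta> N2"
        unfolding \<delta>_def using that by (intro frac_le) auto
      with N2 show ?thesis by (rule order.strict_trans1[rotated])
    qed
    have ordered: "(\<integral>w. \<bar>S i w - S j w\<bar> \<partial>M) < e" if "i \<ge> max N1 N2" "i \<le> j" for i j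
    proof (rule integral_abs_less_if_integral_square_less)
      have "q (\<lambda>w. S i w - S j w) < e\<^sup>2"
        using gap[OF that(2)] N1[of j i] small[of i] small[of j] that
        unfolding abs_less_iff by auto
      then show "(\<integral>w. (S i w - S j w)\<^sup>2 \<partial>M) < e\<^sup>2"
        by (simp add: q_def)
      show "integrable M (\<lambda>w. S i w - S j w)"
        using int[OF S] by simp
      show "integrable M (\<lambda>w. (S i w - S j w)\<^sup>2)"
        using int_sq[OF S] int_mult[OF S S] by (simp add: power2_diff mult.assoc)
    qed (use \<open>e > 0\<close> in auto)
    have "(\<integral>w. norm (S i w - S j w) \<partial>M) < e" if "i \<ge> max N1 N2" "j \<ge> max N1 N2" for i j
      using ordered[of i j] ordered[of j i] that by (cases "i \<le> j") (auto simp: abs_minus_commute)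
    then show ?thesis by blast
  qed
  obtain r where r: "strict_mono r" and Cauchy_r: "AE w in M. Cauchy (\<lambda>i. S (r i) w)"
    using cauchy_L1_AE_cauchy_subseq[OF int[OF S] L1_Cauchy] by blast
  show thesis
  proof (rule that[of "\<lambda>n. S (r n)" "\<lambda>w. lim (\<lambda>n. S (r n) w)"])
    show "S (r n) \<in> C n" for n
      using S[of "r n"] decr[OF seq_suble[OF r]] by blast
    show "(\<lambda>w. lim (\<lambda>n. S (r n) w)) \<in> borel_measurable M"
      using meas[OF S] by measurable
    show "AE w in M. (\<lambda>n. S (r n) w) \<longlonglongrightarrow> lim (\<lambda>n. S (r n) w)"
      using Cauchy_r by eventually_elim (simp add: Cauchy_convergent convergent_LIMSEQ_iff[symmetric])
  qed
qed

section \<open>Existence of the optimal test\<close>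

lemma admissible_tests_midpoint:
  assumes "convex_expectation M \<rho>"
    and "X \<in> admissible_tests M \<rho> K L \<alpha>" "Y \<in> admissible_tests M \<rho> K L \<alpha>"
  shows "(\<lambda>w. (X w + Y w) / 2) \<in> admissible_tests M \<rho> K L \<alpha>"
proof -
  have X: "X \<in> Linf M" "AE w in M. K w \<le> X w \<and> X w \<le> L w" "\<rho> X \<le> \<alpha>"
    and Y: "Y \<in> Linf M" "AE w in M. K w \<le> Y w \<and> Y w \<le> L w" "\<rho> Y \<le> \<alpha>"
    using assms by (auto simp: admissible_tests_def)
  have "AE w in M. K w \<le> (X w + Y w) / 2 \<and> (X w + Y w) / 2 \<le> L w"
    using X(2) Y(2) by eventually_elim auto
  then show ?thesis
    using X Y convex_expectation_midpoint_le[OF assms(1)] by (simp add: admissible_tests_def Linf_midpoint)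
qed

theorem theorem3p1:
  fixes M :: "'a measure"
    and \<rho>\<^sub>1 \<rho>\<^sub>2 :: "('a \<Rightarrow> real) \<Rightarrow> real"
    and K\<^sub>1 K\<^sub>2 :: "'a \<Rightarrow> real"
    and \<alpha> :: real
  assumes "prob_space M"
    and "convex_expectation M \<rho>\<^sub>1" and "continuous_from_below M \<rho>\<^sub>1"
    and "convex_expectation M \<rho>\<^sub>2" and "continuous_from_below M \<rho>\<^sub>2"
    and "K\<^sub>1 \<in> Linf M" and "K\<^sub>2 \<in> Linf M"
    and "AE w in M. 0 \<le> K\<^sub>1 w \<and> K\<^sub>1 w < K\<^sub>2 w"
    and "\<rho>\<^sub>1 K\<^sub>1 \<le> \<alpha>" and "\<alpha> \<le> \<rho>\<^sub>1 K\<^sub>2"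
  shows "\<exists>X' \<in> admissible_tests M \<rho>\<^sub>1 K\<^sub>1 K\<^sub>2 \<alpha>.
           \<rho>\<^sub>2 (\<lambda>w. K\<^sub>2 w - X' w) =
             (INF X \<in> admissible_tests M \<rho>\<^sub>1 K\<^sub>1 K\<^sub>2 \<alpha>. \<rho>\<^sub>2 (\<lambda>w. K\<^sub>2 w - X w))"
proof -
  interpret prob_space M by fact
  define A where "A = admissible_tests M \<rho>\<^sub>1 K\<^sub>1 K\<^sub>2 \<alpha>"
  define f where "f X = \<rho>\<^sub>2 (\<lambda>w. K\<^sub>2 w - X w)" for X
  define m where "m = (INF X\<in>A. f X)"
  define C where "C n = {X \<in> A. f X \<le> m + 1 / real (Suc n)}" for n
  note K = \<open>AE w in M. 0 \<le> K\<^sub>1 w \<and> K\<^sub>1 w < K\<^sub>2 w\<close>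
  obtain B where B: "AE w in M. \<bar>K\<^sub>2 w\<bar> \<le> B"
    using \<open>K\<^sub>2 \<in> Linf M\<close> by (rule Linf_bound)
  have A_Linf: "X \<in> Linf M" and A_between: "AE w in M. K\<^sub>1 w \<le> X w \<and> X w \<le> K\<^sub>2 w"
    and A_level: "\<rho>\<^sub>1 X \<le> \<alpha>" if "X \<in> A" for X
    using that by (auto simp: A_def admissible_tests_def)
  have A_bound: "AE w in M. \<bar>X w\<bar> \<le> B" if "X \<in> A" for X
    using A_between[OF that] K B by eventually_elim auto
  have diff_Linf: "(\<lambda>w. K\<^sub>2 w - X w) \<in> Linf M" if "X \<in> Linf M" for X
    using \<open>K\<^sub>2 \<in> Linf M\<close> that by (rule Linf_diff)
  have "K\<^sub>1 \<in> A"
  proof -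
    have "AE w in M. K\<^sub>1 w \<le> K\<^sub>1 w \<and> K\<^sub>1 w \<le> K\<^sub>2 w"
      using K by eventually_elim auto
    then show ?thesis
      using \<open>K\<^sub>1 \<in> Linf M\<close> \<open>\<rho>\<^sub>1 K\<^sub>1 \<le> \<alpha>\<close> by (simp add: A_def admissible_tests_def)
  qed
  \<comment> \<open>Real infima are meaningful only for sets bounded below; here \<open>\<rho>\<^sub>2 0\<close> is a lower bound.\<close>
  have "\<rho>\<^sub>2 (\<lambda>_. 0) \<le> f X" if "X \<in> A" for X
    unfolding f_def
  proof (rule convex_expectation_mono[OF \<open>convex_expectation M \<rho>\<^sub>2\<close> _ diff_Linf[OF A_Linf[OF that]]])
    show "(\<lambda>_. 0) \<in> Linf M" by (rule LinfI[where C=0]) auto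
    show "AE w in M. 0 \<le> K\<^sub>2 w - X w" using A_between[OF that] by eventually_elim auto
  qed
  then have f_bdd: "bdd_below (f ` A)"
    by (auto simp: bdd_below_def)
  have C_nonempty: "C n \<noteq> {}" for n
  proof -
    have "\<exists>X\<in>A. f X < m + 1 / real (Suc n)"
      using cINF_less_iff[OF _ f_bdd, of "m + 1 / real (Suc n)"] \<open>K\<^sub>1 \<in> A\<close> by (auto simp: m_def)
    then show ?thesis by (auto simp: C_def intro: less_imp_le)
  qed
  have C_decr: "C n' \<subseteq> C n" if "n \<le> n'" for n n'
  proof -
    have "1 / real (Suc n') \<le> 1 / real (Suc n)" using that by (intro frac_le) auto
    then show ?thesis by (auto simp: C_def)
  qed
  have C_midpoint: "(\<lambda>w. (X w + Y w) / 2) \<in> C n" if "X \<in> C n" "Y \<in> C n" for n X Y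
  proof -
    have XY: "X \<in> A" "Y \<in> A" "f X \<le> m + 1 / real (Suc n)" "f Y \<le> m + 1 / real (Suc n)"
      using that by (auto simp: C_def)
    have "(\<lambda>w. K\<^sub>2 w - (X w + Y w) / 2) = (\<lambda>w. ((K\<^sub>2 w - X w) + (K\<^sub>2 w - Y w)) / 2)"
      by (auto simp: field_simps)
    then have "f (\<lambda>w. (X w + Y w) / 2) \<le> m + 1 / real (Suc n)"
      using convex_expectation_midpoint_le[OF \<open>convex_expectation M \<rho>\<^sub>2\<close>
          diff_Linf[OF A_Linf[OF XY(1)]] diff_Linf[OF A_Linf[OF XY(2)]]] XY
      by (simp add: f_def)
    moreover have "(\<lambda>w. (X w + Y w) / 2) \<in> A"
      using admissible_tests_midpoint[OF \<open>convex_expectation M \<rho>\<^sub>1\<close>] XY by (simp add: A_def)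
    ultimately show ?thesis by (simp add: C_def)
  qed
  \<comment> \<open>\<open>X\<close> is a minimizing sequence that also converges almost everywhere.\<close>
  obtain X Y where X: "\<And>n. X n \<in> C n" and Y: "Y \<in> borel_measurable M"
    and conv: "AE w in M. (\<lambda>n. X n w) \<longlonglongrightarrow> Y w"
  proof (rule decreasing_midpoint_convex_AE_convergent_selection[of C B])
    show "X \<in> borel_measurable M" "AE w in M. \<bar>X w\<bar> \<le> B" if "X \<in> C n" for n X
      using that Linf_measurable[OF A_Linf] A_bound by (simp_all add: C_def)
  qed (use C_decr C_nonempty C_midpoint in blast)+
  have XA: "X n \<in> A" and Xf: "f (X n) \<le> m + 1 / real (Suc n)" for n
    using X[of n] by (auto simp: C_def)
  have between: "AE w in M. \<forall>n. K\<^sub>1 w \<le> X n w \<and> X n w \<le> K\<^sub>2 w"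
    using A_between[OF XA] by (simp add: AE_all_countable)
  have Y_between: "AE w in M. K\<^sub>1 w \<le> Y w \<and> Y w \<le> K\<^sub>2 w"
    using between conv by eventually_elim (blast intro: LIMSEQ_le_const LIMSEQ_le_const2)
  have "AE w in M. \<bar>Y w\<bar> \<le> B"
    using Y_between K B by eventually_elim auto
  with Y have Y_Linf: "Y \<in> Linf M"
    by (rule LinfI)
  have X_bound: "AE w in M. \<forall>n. \<bar>X n w\<bar> \<le> B"
    using A_bound[OF XA] by (simp add: AE_all_countable)
  have "\<rho>\<^sub>1 Y \<le> \<alpha>"
    using \<open>convex_expectation M \<rho>\<^sub>1\<close> \<open>continuous_from_below M \<rho>\<^sub>1\<close> A_Linf[OF XA] Y_Linf X_bound conv
      A_level[OF XA] tendsto_const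
    by (rule continuous_from_below_Fatou)
  then have "Y \<in> A"
    using Y_Linf Y_between by (simp add: A_def admissible_tests_def)
  have "f Y \<le> m"
    unfolding f_def
  proof (rule continuous_from_below_Fatou[OF \<open>convex_expectation M \<rho>\<^sub>2\<close> \<open>continuous_from_below M \<rho>\<^sub>2\<close>
        diff_Linf[OF A_Linf[OF XA]] diff_Linf[OF Y_Linf]])
    show "AE w in M. \<forall>n. \<bar>K\<^sub>2 w - X n w\<bar> \<le> B"
      using between K B
    proof eventually_elim
      case (elim w)
      show ?case
      proof
        fix n
        show "\<bar>K\<^sub>2 w - X n w\<bar> \<le> B" using elim(1)[rule_format, of n] elim(2,3) by linarith
      qed
    qed
    show "AE w in M. (\<lambda>n. K\<^sub>2 w - X n w) \<longlonglongrightarrow> K\<^sub>2 w - Y w"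
      using conv by eventually_elim (intro tendsto_intros)
    show "\<rho>\<^sub>2 (\<lambda>w. K\<^sub>2 w - X n w) \<le> m + 1 / real (Suc n)" for n
      using Xf by (simp add: f_def)
    show "(\<lambda>n. m + 1 / real (Suc n)) \<longlonglongrightarrow> m"
      using tendsto_add[OF tendsto_const[of m] LIMSEQ_inverse_real_of_nat] by (simp add: inverse_eq_divide)
  qed
  moreover have "m \<le> f Y"
    unfolding m_def using f_bdd \<open>Y \<in> A\<close> by (rule cINF_lower)
  ultimately show ?thesis
    using \<open>Y \<in> A\<close> unfolding A_def f_def m_def by (intro bexI[of _ Y]) auto
qed

end
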